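(* Let $H$ be a finite graph, possibly with loops. If $H$ has no alternating 4-circuit, then $H$ is a bipartite swapping target.
   Context: All graphs are finite and undirected; $H$ may have loops but no multiple edges. $\operatorname{Hom}(G,H)$ is the set of maps $f:V(G)\to V(H)$ with $f(u)f(v)\in E(H)$ for all $uv\in E(G)$ ($vv$ denotes a loop at $v$). An alternating 4-circuit in $H$ is a sequence $a,b,c,d\in V(H)$ (not necessarily distinct) such that $ab,cd\in E(H)$ and $bc,da\notin E(H)$. For a simple graph $G$, $G \sqcup G$ is the disjoint union of two copies of $G$, with vertices $v_i$ ($v\in V(G)$, $i\in\{0,1\}$) and edges $u_iv_i$ for $uv\in E(G)$, $i\in\{0,1\}$. For $f\in\operatorname{Hom}(G\sqcup G,H)$, an edge $uv\in E(G)$ is violated with respect to $f$ if $f(u_i)f(v_j)\notin E(H)$ for some $i,j\in\{0,1\}$. The homomorphism $f$ has the bipartite swapping property if the edges of $G$ violated with respect to $f$ form a bipartite subgraph of $G$. $H$ is a bipartite swapping target if for every finite simple graph $G$, every $f\in\operatorname{Hom}(G\sqcup G,H)$ has the bipartite swapping property. *)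

theory Defs
  imports "Graph_Theory.Pair_Digraph" "HOL-Library.FuncSet"
begin

text \<open>
  An undirected graph without multiple edges is a symmetric digraph whose arcs are ordered pairs
  of vertices: the edge \<open>uv\<close> is the presence of \<open>(u, v)\<close> (equivalently \<open>(v, u)\<close>) in \<open>parcs G\<close>,
  and a loop at \<open>v\<close> is the arc \<open>(v, v)\<close>.  Thus \<^const>\<open>pair_pseudo_graph\<close> is the predicate
  ``finite undirected graph, loops allowed, no multiple edges'', and \<^const>\<open>pair_graph\<close> is
  ``finite simple graph''.
\<close>

definition Hom :: "'a pair_pre_digraph \<Rightarrow> 'b pair_pre_digraph \<Rightarrow> ('a \<Rightarrow> 'b) set" where
  "Hom G H = {f \<in> pverts G \<rightarrow>\<^sub>E pverts H. \<forall>u v. (u, v) \<in> parcs G \<longrightarrow> (f u, f v) \<in> parcs H}"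

definition alternating_4_circuit ::
    "'b pair_pre_digraph \<Rightarrow> 'b \<Rightarrow> 'b \<Rightarrow> 'b \<Rightarrow> 'b \<Rightarrow> bool" where
  "alternating_4_circuit H a b c d \<longleftrightarrow>
     a \<in> pverts H \<and> b \<in> pverts H \<and> c \<in> pverts H \<and> d \<in> pverts H \<and>
     (a, b) \<in> parcs H \<and> (c, d) \<in> parcs H \<and> (b, c) \<notin> parcs H \<and> (d, a) \<notin> parcs H"

text \<open>
  The disjoint union of two copies of \<open>G\<close>; the index set \<open>{0, 1}\<close> of the copies is rendered by
  \<^typ>\<open>bool\<close>, so the vertex \<open>v\<^sub>i\<close> is \<open>(v, i)\<close>.
\<close>

definition two_copies :: "'a pair_pre_digraph \<Rightarrow> ('a \<times> bool) pair_pre_digraph" where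
  "two_copies G =
     \<lparr> pverts = pverts G \<times> UNIV, parcs = {((u, i), (v, i)) | u v i. (u, v) \<in> parcs G} \<rparr>"

definition bipartite :: "'a pair_pre_digraph \<Rightarrow> bool" where
  "bipartite G \<longleftrightarrow>
     (\<exists>A B. A \<union> B = pverts G \<and> A \<inter> B = {} \<and>
        (\<forall>u v. (u, v) \<in> parcs G \<longrightarrow> u \<in> A \<and> v \<in> B \<or> u \<in> B \<and> v \<in> A))"

definition violated ::
    "'b pair_pre_digraph \<Rightarrow> ('a \<times> bool \<Rightarrow> 'b) \<Rightarrow> 'a \<Rightarrow> 'a \<Rightarrow> bool" where
  "violated H f u v \<longleftrightarrow> (\<exists>i j. (f (u, i), f (v, j)) \<notin> parcs H)"

definition violated_subgraph ::
    "'a pair_pre_digraph \<Rightarrow> 'b pair_pre_digraph \<Rightarrow> ('a \<times> bool \<Rightarrow> 'b) \<Rightarrow> 'a pair_pre_digraph" where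
  "violated_subgraph G H f =
     \<lparr> pverts = pverts G, parcs = {(u, v) \<in> parcs G. violated H f u v} \<rparr>"

definition bipartite_swapping_property ::
    "'a pair_pre_digraph \<Rightarrow> 'b pair_pre_digraph \<Rightarrow> ('a \<times> bool \<Rightarrow> 'b) \<Rightarrow> bool" where
  "bipartite_swapping_property G H f \<longleftrightarrow> bipartite (violated_subgraph G H f)"

text \<open>
  HOL cannot quantify over types inside a definition, so the type \<open>'a\<close> of the vertices of the test
  graphs \<open>G\<close> is passed as an argument.  A theorem concluding this for a type variable \<open>'a\<close> that
  does not occur in its assumptions covers finite simple graphs over every vertex type.
\<close>

definition bipartite_swapping_target :: "'a itself \<Rightarrow> 'b pair_pre_digraph \<Rightarrow> bool" where
  "bipartite_swapping_target _ H \<longleftrightarrow>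
     (\<forall>G :: 'a pair_pre_digraph. pair_graph G \<longrightarrow>
        (\<forall>f \<in> Hom (two_copies G) H. bipartite_swapping_property G H f))"

end

theory Submission
  imports Defs
begin

text \<open>
  Without alternating 4-circuits, the neighbourhoods of the vertices of \<open>H\<close> form a chain under
  inclusion: \<open>b \<in> N(a) - N(c)\<close> and \<open>d \<in> N(c) - N(a)\<close> would give the circuit \<open>a, b, c, d\<close>.
  This linear order two-colours the violated edges. Given a homomorphism \<open>f\<close> from two copies of
  \<open>G\<close>, write \<open>x\<^sub>i\<close> for the image of the \<open>i\<close>-th copy of the vertex \<open>x\<close>, and colour \<open>x\<close> according to
  whether \<open>N(x\<^sub>1)\<close> exceeds \<open>N(x\<^sub>0)\<close>. If \<open>uv\<close> is violated because \<open>u\<^sub>0v\<^sub>1\<close> is not an edge, then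
  \<open>v\<^sub>1\<close> lies in \<open>N(u\<^sub>1) - N(u\<^sub>0)\<close>, whereas \<open>u\<^sub>0\<close> lies in \<open>N(v\<^sub>0) - N(v\<^sub>1)\<close>; so going from copy 0
  to copy 1 the neighbourhood grows at \<open>u\<close> and shrinks at \<open>v\<close>, and the two ends get different
  colours. The other kind of violation is this one with \<open>u\<close> and \<open>v\<close> exchanged.
\<close>

lemma neighbourhoods_nested:
  assumes "pair_pseudo_graph H"
    and "\<not> (\<exists>a b c d. alternating_4_circuit H a b c d)"
    and "(a, b) \<in> parcs H" "(c, b) \<notin> parcs H" "(c, d) \<in> parcs H"
  shows "(a, d) \<in> parcs H"
proof -
  interpret H: pair_pseudo_graph H by fact
  have sym: "(x, y) \<in> parcs H \<longleftrightarrow> (y, x) \<in> parcs H" for x y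
    using H.arcs_symmetric by blast
  have "a \<in> pverts H" "b \<in> pverts H" "c \<in> pverts H" "d \<in> pverts H"
    using assms(3,5) H.in_arcsD1 H.in_arcsD2 by blast+
  with assms(2-5) sym show ?thesis
    unfolding alternating_4_circuit_def by blast
qed

theorem proposition4p9:
  fixes H :: "'b pair_pre_digraph"
  assumes "pair_pseudo_graph H"
    and "\<not> (\<exists>a b c d. alternating_4_circuit H a b c d)"
  shows "bipartite_swapping_target TYPE('a) H"
  unfolding bipartite_swapping_target_def
proof (intro allI impI ballI)
  fix G :: "'a pair_pre_digraph" and f
  assume G: "pair_graph G" and f: "f \<in> Hom (two_copies G) H"
  interpret H: pair_pseudo_graph H by fact
  interpret G: pair_graph G by fact
  have symH: "(y, x) \<in> parcs H" if "(x, y) \<in> parcs H" for x y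
    using that H.arcs_symmetric by blast
  have symG: "(v, u) \<in> parcs G" if "(u, v) \<in> parcs G" for u v
    using that G.arcs_symmetric by blast
  have hom: "(f (u, i), f (v, i)) \<in> parcs H" if "(u, v) \<in> parcs G" for u v i
    using f that unfolding Hom_def two_copies_def by auto
  define grows where
    "grows x \<longleftrightarrow> (\<exists>y. (f (x, True), y) \<in> parcs H \<and> (f (x, False), y) \<notin> parcs H)" for x
  have colours: "grows u \<and> \<not> grows v"
    if uv: "(u, v) \<in> parcs G" and no: "(f (u, False), f (v, True)) \<notin> parcs H" for u v
  proof
    show "grows u"
      unfolding grows_def using hom[OF uv] no by blast
    have "(f (v, False), f (u, False)) \<in> parcs H" "(f (v, True), f (u, False)) \<notin> parcs H"
      using hom[OF uv] no symH by blast+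
    then show "\<not> grows v"
      unfolding grows_def using neighbourhoods_nested[OF assms] by blast
  qed
  have "grows u \<noteq> grows v" if uv: "(u, v) \<in> parcs G" and viol: "violated H f u v" for u v
  proof -
    from viol obtain i j where ij: "(f (u, i), f (v, j)) \<notin> parcs H"
      unfolding violated_def by blast
    with hom[OF uv] have "i \<noteq> j" by blast
    with ij have "(f (u, False), f (v, True)) \<notin> parcs H \<or> (f (v, False), f (u, True)) \<notin> parcs H"
      using symH by (cases i; cases j) auto
    then show ?thesis
      using colours uv symG by blast
  qed
  moreover have "u \<in> pverts G" "v \<in> pverts G" if "(u, v) \<in> parcs G" for u v
    using that G.in_arcsD1 G.in_arcsD2 by blast+
  ultimately show "bipartite_swapping_property G H f"
    unfolding bipartite_swapping_property_def bipartite_def violated_subgraph_def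
    by (intro exI[of _ "{x \<in> pverts G. grows x}"] exI[of _ "{x \<in> pverts G. \<not> grows x}"]) auto
qed

end
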